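(* Let $\mathbf{E}$ be a Euclidean space. Assume $B\subset\mathbf{E}$ is a subspace and that $A\subset\mathbf{E}$ is closed and super-regular at $\hat x\in S:=A\cap B$. If the collection $\{A,B\}$ is strongly regular at $S$ (that is, at every point of $S$), then there is a $\delta>0$ such that $$\frac{1-c}{\kappa^2}>2\varepsilon+2\varepsilon^2$$ and hence $$d(x_+,S)\le\tilde c\,d(x,S)\qquad\forall x_+\in T_{DR}x,$$ with $\tilde c=\sqrt{1+2\varepsilon+2\varepsilon^2-\frac{1-c}{\kappa^2}}<1$, for all $x\in\mathbb{B}_{\delta/2}(\hat x)$. Here $\kappa$, $c$ and $\varepsilon$ are, respectively, the linear regularity constant of $\{A,B\}$, the normal-cone angle constant of $\{A,B\}$, and the subregularity constant of $A$ on $\mathbb{B}_\delta(\hat x)$, as described in the context.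
   Context: $\mathbb{B}_\rho(\hat x)$ is the closed ball of radius $\rho$ about $\hat x$, $\mathbb{B}_\rho$ the closed ball of radius $\rho$ about $0$, and $\mathbb{B}=\mathbb{B}_1$. For nonempty $\Omega\subset\mathbf{E}$, $d(x,\Omega)=\inf_{y\in\Omega}\|x-y\|$, the (multi-valued) projector is $P_\Omega x=\{y\in\Omega:\|x-y\|=d(x,\Omega)\}$, and the reflector is $R_\Omega x=2P_\Omega x-x=\{2p-x:p\in P_\Omega x\}$. Composition of multi-valued maps: $T_2T_1x=\bigcup_{y\in T_1x}T_2y$. The Douglas-Rachford operator is $T_{DR}x=\frac12(R_AR_Bx+x)=\{\frac12(w+x):w\in R_AR_Bx\}$. The proximal normal cone at $x\in\Omega$ is $N^P_\Omega(x)=\mathrm{cone}(P_\Omega^{-1}(x)-x)$, where $P_\Omega^{-1}(x)=\{w:x\in P_\Omega w\}$ and $\mathrm{cone}(K)$ is the smallest cone (set closed under multiplication by positive scalars) containing $K$. The limiting normal cone $N_\Omega(x)$ consists of all $v$ for which there are $x_k\in\Omega$, $v_k\in N^P_\Omega(x_k)$ with $x_k\to x$ and $v_k\to v$. $\Omega$ is super-regular at $\hat x\in\Omega$ if for every $\varepsilon>0$ there is $\delta>0$ such that $\langle v,\bar x-x\rangle\le\varepsilon\|v\|\|\bar x-x\|$ for all $x,\bar x\in\mathbb{B}_\delta(\hat x)\cap\Omega$ and $v\in N_\Omega(x)$. A collection of closed nonempty sets $\Omega_1,\dots,\Omega_m$ is strongly regular at a point $\bar x$ if there are $\alpha>0$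 and $\delta>0$ such that $\left(\bigcap_{i=1}^m(\Omega_i-\omega_i-a_i)\right)\cap\mathbb{B}_\rho\ne\emptyset$ for all $\rho\in(0,\delta]$, $\omega_i\in\Omega_i\cap\mathbb{B}_\delta(\bar x)$, $a_i\in\mathbb{B}_{\alpha\rho}$, $i=1,\dots,m$. Meaning of the constants, which are chosen along with $\delta$: $\kappa>0$ is a constant of local linear regularity of $\{A,B\}$ at $\hat x$ on $\mathbb{B}_\delta(\hat x)$, i.e. $d(x,A\cap B)\le\kappa\max\{d(x,A),d(x,B)\}$ for all $x\in\mathbb{B}_\delta(\hat x)$; $c\in(0,1)$ is a constant such that $\langle u,v\rangle\ge-c$ for all $z\in A\cap\mathbb{B}_\delta(\hat x)$, $u\in N_A(z)\cap\mathbb{B}$, $y\in B\cap\mathbb{B}_\delta(\hat x)$, $v\in N_B(y)\cap\mathbb{B}$; and $\varepsilon$ is a constant such that $A$ is $(\varepsilon,\delta)$-subregular at $\hat x$ with respect to $S$, i.e. $\langle v,\bar x-x\rangle\le\varepsilon\|v\|\|\bar x-x\|$ for all $x\in\mathbb{B}_\delta(\hat x)\cap A$, $\bar x\in S\cap\mathbb{B}_\delta(\hat x)$, $v\in N^P_A(x)$. *)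

theory Defs
  imports "HOL-Analysis.Analysis"
begin

definition projector :: "'a::euclidean_space set \<Rightarrow> 'a \<Rightarrow> 'a set" where
  "projector \<Omega> x = {y \<in> \<Omega>. norm (x - y) = infdist x \<Omega>}"

definition reflector :: "'a::euclidean_space set \<Rightarrow> 'a \<Rightarrow> 'a set" where
  "reflector \<Omega> x = {2 *\<^sub>R p - x | p. p \<in> projector \<Omega> x}"

definition mcomp :: "('b \<Rightarrow> 'c set) \<Rightarrow> ('a \<Rightarrow> 'b set) \<Rightarrow> 'a \<Rightarrow> 'c set" where
  "mcomp T2 T1 x = (\<Union>y\<in>T1 x. T2 y)"

definition douglas_rachford :: "'a::euclidean_space set \<Rightarrow> 'a set \<Rightarrow> 'a \<Rightarrow> 'a set" where
  "douglas_rachford A B x =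
    {(1/2) *\<^sub>R (w + x) | w. w \<in> mcomp (reflector A) (reflector B) x}"

text \<open>The library's \<open>cone\<close> demands closure under nonnegative scalars; here only positive
  scalars are used.\<close>

definition pos_cone :: "'a::real_vector set \<Rightarrow> bool" where
  "pos_cone K \<longleftrightarrow> (\<forall>k\<in>K. \<forall>t>0. t *\<^sub>R k \<in> K)"

definition prox_normal_cone :: "'a::euclidean_space set \<Rightarrow> 'a \<Rightarrow> 'a set" where
  "prox_normal_cone \<Omega> x = pos_cone hull {w - x | w. x \<in> projector \<Omega> w}"

lemma pos_cone_hull_eq:
  "pos_cone hull K = {t *\<^sub>R k | t k. 0 < t \<and> k \<in> K}" (is "_ = ?C")
proof (rule hull_unique)
  show "K \<subseteq> ?C"
    by (force intro: exI[of _ "1::real"])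
  show "pos_cone ?C"
    unfolding pos_cone_def
  proof (intro ballI allI impI)
    fix x and t :: real
    assume "x \<in> ?C" and t: "0 < t"
    then obtain s k where "x = s *\<^sub>R k" "0 < s" "k \<in> K" by blast
    with t have "t *\<^sub>R x = (t * s) *\<^sub>R k \<and> 0 < t * s \<and> k \<in> K" by simp
    then show "t *\<^sub>R x \<in> ?C" by blast
  qed
  show "?C \<subseteq> T" if "K \<subseteq> T" "pos_cone T" for T
    using that by (auto simp: pos_cone_def)
qed

definition limiting_normal_cone :: "'a::euclidean_space set \<Rightarrow> 'a \<Rightarrow> 'a set" where
  "limiting_normal_cone \<Omega> x =
    {v. \<exists>X V. (\<forall>k::nat. X k \<in> \<Omega> \<and> V k \<in> prox_normal_cone \<Omega> (X k)) \<and>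
              X \<longlonglongrightarrow> x \<and> V \<longlonglongrightarrow> v}"

definition super_regular :: "'a::euclidean_space set \<Rightarrow> 'a \<Rightarrow> bool" where
  "super_regular \<Omega> xhat \<longleftrightarrow>
    (\<forall>\<epsilon>>0. \<exists>\<delta>>0. \<forall>x \<in> cball xhat \<delta> \<inter> \<Omega>. \<forall>xbar \<in> cball xhat \<delta> \<inter> \<Omega>.
       \<forall>v \<in> limiting_normal_cone \<Omega> x.
         inner v (xbar - x) \<le> \<epsilon> * norm v * norm (xbar - x))"

definition subregular ::
  "real \<Rightarrow> real \<Rightarrow> 'a::euclidean_space set \<Rightarrow> 'a \<Rightarrow> 'a set \<Rightarrow> bool" where
  "subregular \<epsilon> \<delta> \<Omega> xhat S \<longleftrightarrow>
    (\<forall>x \<in> cball xhat \<delta> \<inter> \<Omega>. \<forall>xbar \<in> S \<inter> cball xhat \<delta>. \<forall>v \<in> prox_normal_cone \<Omega> x.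
       inner v (xbar - x) \<le> \<epsilon> * norm v * norm (xbar - x))"

text \<open>A finite collection is given as a list, so that repeated sets keep their own
  translations \<open>\<omega> i\<close> and \<open>a i\<close>.\<close>

definition strongly_regular :: "'a::euclidean_space set list \<Rightarrow> 'a \<Rightarrow> bool" where
  "strongly_regular \<Omega>s x \<longleftrightarrow>
    (\<exists>\<alpha>>0. \<exists>\<delta>>0. \<forall>\<rho>\<in>{0<..\<delta>}. \<forall>\<omega> a.
       (\<forall>i<length \<Omega>s. \<omega> i \<in> \<Omega>s ! i \<inter> cball x \<delta> \<and> a i \<in> cball 0 (\<alpha> * \<rho>)) \<longrightarrow>
       (\<Inter>i<length \<Omega>s. (\<lambda>y. y - \<omega> i - a i) ` (\<Omega>s ! i)) \<inter> cball 0 \<rho> \<noteq> {})"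

definition linear_regularity_constant ::
  "real \<Rightarrow> 'a::euclidean_space set \<Rightarrow> 'a set \<Rightarrow> 'a \<Rightarrow> real \<Rightarrow> bool" where
  "linear_regularity_constant \<kappa> A B xhat \<delta> \<longleftrightarrow>
    (\<forall>x \<in> cball xhat \<delta>. infdist x (A \<inter> B) \<le> \<kappa> * max (infdist x A) (infdist x B))"

definition normal_angle_constant ::
  "real \<Rightarrow> 'a::euclidean_space set \<Rightarrow> 'a set \<Rightarrow> 'a \<Rightarrow> real \<Rightarrow> bool" where
  "normal_angle_constant c A B xhat \<delta> \<longleftrightarrow>
    (\<forall>z \<in> A \<inter> cball xhat \<delta>. \<forall>u \<in> limiting_normal_cone A z \<inter> cball 0 1.
     \<forall>y \<in> B \<inter> cball xhat \<delta>. \<forall>v \<in> limiting_normal_cone B y \<inter> cball 0 1.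
       inner u v \<ge> - c)"

end

theory Submission
  imports Defs
begin

text \<open>Strong regularity at \<open>xhat\<close> with constant \<open>\<alpha>\<close> supplies both constants at once. Applied to
  \<open>\<omega>\<^sub>1 \<in> P\<^sub>A x\<close>, \<open>\<omega>\<^sub>2 \<in> P\<^sub>B x\<close> and \<open>a\<^sub>i = x - \<omega>\<^sub>i\<close> it puts a point of \<open>A \<inter> B\<close> within \<open>1 / \<alpha>\<close> times
  \<open>max (d x A) (d x B)\<close> of \<open>x\<close>, so \<open>\<kappa> = 1 / \<alpha>\<close>. Applied to base points of unit proximal normals
  \<open>u\<close>, \<open>v\<close> with shifts \<open>\<alpha> \<rho> u\<close>, \<open>\<alpha> \<rho> v\<close> it gives \<open>\<parallel>u + v\<parallel> \<ge> 2 \<alpha>\<close> as \<open>\<rho> \<rightarrow> 0\<close>, so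
  \<open>c = 1 - 2 \<alpha>\<^sup>2\<close>. Hence \<open>(1 - c) / \<kappa>\<^sup>2 = 2 \<alpha>\<^sup>4\<close>, and super-regularity allows \<open>\<epsilon> = \<alpha>\<^sup>4 / 2\<close>. A Douglas-Rachford step is \<open>x\<^sub>+ = x + z - y\<close> with \<open>y = P\<^sub>B x\<close>, \<open>w = 2 y - x\<close> and
  \<open>z \<in> P\<^sub>A w\<close>. Subregularity makes it almost firmly nonexpansive,
  \<open>\<parallel>x\<^sub>+ - s\<parallel>\<^sup>2 + \<parallel>z - y\<parallel>\<^sup>2 \<le> (1 + 2 \<epsilon> + 2 \<epsilon>\<^sup>2) \<parallel>x - s\<parallel>\<^sup>2\<close> for \<open>s \<in> A \<inter> B\<close>, and the angle bound for
  the normals \<open>w - z\<close> and \<open>x - y\<close>, together with linear regularity at \<open>w\<close>, makes \<open>\<parallel>z - y\<parallel>\<close> large.\<close>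

section \<open>Proximal and limiting normals\<close>

lemma prox_normal_coneI: "z \<in> projector \<Omega> w \<Longrightarrow> w - z \<in> prox_normal_cone \<Omega> z"
  unfolding prox_normal_cone_def by (rule hull_inc) blast

text \<open>If \<open>x\<close> is nearest to \<open>w\<close>, expanding
  \<open>norm (w - x) \<le> norm (w - y)\<close> leaves a second-order bound. For displacements of
  size O(\<rho>) this error vanishes after division by \<rho> as \<rho> tends to 0.\<close>

lemma prox_normal_cone_quadratic:
  assumes "v \<in> prox_normal_cone \<Omega> x"
  obtains C where "\<And>y. y \<in> \<Omega> \<Longrightarrow> inner v (y - x) \<le> C * (norm (y - x))\<^sup>2"
proof -
  obtain t w where t: "t > 0" and v: "v = t *\<^sub>R (w - x)" and x: "x \<in> projector \<Omega> w"
    using assms unfolding prox_normal_cone_def pos_cone_hull_eq by blast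
  have "inner v (y - x) \<le> t / 2 * (norm (y - x))\<^sup>2" if "y \<in> \<Omega>" for y
  proof -
    have "norm (w - x) \<le> norm (w - y)"
      using x infdist_le[OF that, of w] by (simp add: projector_def dist_norm)
    then have "(norm (w - x))\<^sup>2 \<le> (norm (w - y))\<^sup>2"
      by (simp add: power_mono)
    also have "w - y = (w - x) - (y - x)" by simp
    also have "(norm \<dots>)\<^sup>2 = (norm (w - x))\<^sup>2 - 2 * inner (w - x) (y - x) + (norm (y - x))\<^sup>2"
      unfolding power2_norm_eq_inner by (simp add: algebra_simps inner_commute)
    finally have "inner (w - x) (y - x) \<le> (norm (y - x))\<^sup>2 / 2" by simp
    then show ?thesis
      using mult_left_mono[of _ _ t] t by (fastforce simp: v)
  qed
  then show ?thesis by (rule that)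
qed

lemma prox_normal_cone_scaleR:
  assumes "v \<in> prox_normal_cone \<Omega> x" "t > 0"
  shows "t *\<^sub>R v \<in> prox_normal_cone \<Omega> x"
proof -
  obtain s w where "s > 0" "v = s *\<^sub>R (w - x)" "x \<in> projector \<Omega> w"
    using assms(1) unfolding prox_normal_cone_def pos_cone_hull_eq by blast
  then have "t *\<^sub>R v = (t * s) *\<^sub>R (w - x)" "0 < t * s"
    using assms(2) by simp_all
  then show ?thesis
    using \<open>x \<in> projector \<Omega> w\<close> unfolding prox_normal_cone_def pos_cone_hull_eq by blast
qed

lemma prox_normal_cone_subset_limiting:
  assumes "x \<in> \<Omega>"
  shows "prox_normal_cone \<Omega> x \<subseteq> limiting_normal_cone \<Omega> x"
proof
  fix v assume "v \<in> prox_normal_cone \<Omega> x"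
  then show "v \<in> limiting_normal_cone \<Omega> x"
    unfolding limiting_normal_cone_def mem_Collect_eq using assms
    by (intro exI[of _ "\<lambda>_. x"] exI[of _ "\<lambda>_. v"]) auto
qed

section \<open>Regularity and angle constants from strong regularity\<close>

text \<open>The vector \<open>d\<close> is a common point of the two translated sets. Capping
  \<alpha> at 1/2 only restricts the admissible shifts; it later keeps
  \<open>1 - 2 * \<alpha>\<^sup>2\<close> positive.\<close>

lemma strongly_regular_pairE:
  fixes A B :: "'a::euclidean_space set"
  assumes "strongly_regular [A, B] x"
  obtains \<alpha> \<delta> where "0 < \<alpha>" "\<alpha> \<le> 1 / 2" "0 < \<delta>"
    "\<And>\<rho> p q a b. \<lbrakk>0 < \<rho>; \<rho> \<le> \<delta>; p \<in> A; q \<in> B; dist x p \<le> \<delta>; dist x q \<le> \<delta>;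
        norm a \<le> \<alpha> * \<rho>; norm b \<le> \<alpha> * \<rho>\<rbrakk>
      \<Longrightarrow> \<exists>d. norm d \<le> \<rho> \<and> p + a + d \<in> A \<and> q + b + d \<in> B"
proof -
  obtain \<alpha> \<delta> where "\<alpha> > 0" "\<delta> > 0"
    and *: "\<forall>\<rho>\<in>{0<..\<delta>}. \<forall>\<omega> a.
       (\<forall>i<length [A, B]. \<omega> i \<in> [A, B] ! i \<inter> cball x \<delta> \<and> a i \<in> cball 0 (\<alpha> * \<rho>)) \<longrightarrow>
       (\<Inter>i<length [A, B]. (\<lambda>y. y - \<omega> i - a i) ` ([A, B] ! i)) \<inter> cball 0 \<rho> \<noteq> {}"
    using assms unfolding strongly_regular_def by blast
  show ?thesis
  proof
    show "0 < min \<alpha> (1 / 2)" "min \<alpha> (1 / 2) \<le> 1 / 2" "0 < \<delta>"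
      using \<open>\<alpha> > 0\<close> \<open>\<delta> > 0\<close> by auto
    fix \<rho> :: real and p q a b :: 'a
    assume \<rho>: "0 < \<rho>" "\<rho> \<le> \<delta>" and pq: "p \<in> A" "q \<in> B" "dist x p \<le> \<delta>" "dist x q \<le> \<delta>"
      and ab: "norm a \<le> min \<alpha> (1 / 2) * \<rho>" "norm b \<le> min \<alpha> (1 / 2) * \<rho>"
    have "min \<alpha> (1 / 2) * \<rho> \<le> \<alpha> * \<rho>" using \<rho> by (intro mult_right_mono) auto
    with ab have ab': "norm a \<le> \<alpha> * \<rho>" "norm b \<le> \<alpha> * \<rho>" by linarith+
    define \<omega> where "\<omega> i = (if i = 0 then p else q)" for i :: nat
    define s where "s i = (if i = 0 then a else b)" for i :: nat
    have \<omega>s: "\<forall>i<length [A, B]. \<omega> i \<in> [A, B] ! i \<inter> cball x \<delta> \<and> s i \<in> cball 0 (\<alpha> * \<rho>)"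
      using pq ab' by (auto simp: \<omega>_def s_def less_Suc_eq)
    let ?T = "(\<Inter>i<length [A, B]. (\<lambda>y. y - \<omega> i - s i) ` ([A, B] ! i)) \<inter> cball 0 \<rho>"
    have "?T \<noteq> {}"
      using * \<rho> \<omega>s by simp
    then obtain d where dT: "d \<in> ?T" by (meson ex_in_conv)
    then have d: "norm d \<le> \<rho>" by (simp only: Int_iff mem_cball_0)
    have mem: "d \<in> (\<lambda>y. y - \<omega> i - s i) ` ([A, B] ! i)" if "i < length [A, B]" for i
      by (rule INT_D[OF IntD1[OF dT]]) (use that in simp)
    have shift: "e + f + d \<in> X" if "d \<in> (\<lambda>y. y - e - f) ` X" for e f X
      using that by (auto simp: algebra_simps)
    have "d \<in> (\<lambda>y. y - p - a) ` A"
      using mem[of 0] by (simp only: \<omega>_def s_def) simp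
    moreover have "d \<in> (\<lambda>y. y - q - b) ` B"
      using mem[of 1] by (simp only: \<omega>_def s_def) simp
    ultimately have "p + a + d \<in> A" "q + b + d \<in> B"
      by (simp_all only: shift)
    with d show "\<exists>d. norm d \<le> \<rho> \<and> p + a + d \<in> A \<and> q + b + d \<in> B" by blast
  qed
qed

text \<open>Each base point is pushed by \<alpha>\<rho> along its own normal, and \<open>d\<close>
  must bring both back into the sets. The quadratic bounds give
  \<open>\<alpha> * \<rho> + inner u d \<le> O(\<rho>\<^sup>2)\<close> and likewise for
  \<open>v\<close>; summing, applying Cauchy-Schwarz with \<open>norm d \<le> \<rho>\<close>,
  dividing by \<rho> and letting \<rho> tend to 0 gives the claim.\<close>

lemma norm_add_unit_prox_normals_ge:
  assumes "0 < \<alpha>" "0 < \<delta>"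
    and reg: "\<And>\<rho> a b. \<lbrakk>0 < \<rho>; \<rho> \<le> \<delta>; norm a \<le> \<alpha> * \<rho>; norm b \<le> \<alpha> * \<rho>\<rbrakk>
      \<Longrightarrow> \<exists>d. norm d \<le> \<rho> \<and> p + a + d \<in> A \<and> q + b + d \<in> B"
    and u: "u \<in> prox_normal_cone A p" "norm u = 1"
    and v: "v \<in> prox_normal_cone B q" "norm v = 1"
  shows "2 * \<alpha> \<le> norm (u + v)"
proof -
  obtain C where C: "\<And>y. y \<in> A \<Longrightarrow> inner u (y - p) \<le> C * (norm (y - p))\<^sup>2"
    using prox_normal_cone_quadratic[OF u(1)] by blast
  obtain D where D: "\<And>y. y \<in> B \<Longrightarrow> inner v (y - q) \<le> D * (norm (y - q))\<^sup>2"
    using prox_normal_cone_quadratic[OF v(1)] by blast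
  \<comment> \<open>Both displacements have length at most \<open>(\<alpha> + 1) * \<rho>\<close>;
    absolute values are taken because \<open>C\<close> and \<open>D\<close> may be negative.\<close>
  define K where "K = (\<bar>C\<bar> + \<bar>D\<bar>) * (\<alpha> + 1)\<^sup>2"
  have "2 * \<alpha> \<le> norm (u + v) + K * \<rho>" if \<rho>: "0 < \<rho>" "\<rho> \<le> \<delta>" for \<rho>
  proof -
    define a where "a = (\<alpha> * \<rho>) *\<^sub>R u"
    define b where "b = (\<alpha> * \<rho>) *\<^sub>R v"
    have ab: "norm a \<le> \<alpha> * \<rho>" "norm b \<le> \<alpha> * \<rho>"
      using \<rho> \<open>0 < \<alpha>\<close> u(2) v(2) by (simp_all add: a_def b_def)
    obtain d where d: "norm d \<le> \<rho>" "p + a + d \<in> A" "q + b + d \<in> B"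
      using reg[OF \<rho> ab] by blast
    have sq: "E * (norm (e + d))\<^sup>2 \<le> \<bar>E\<bar> * ((\<alpha> + 1)\<^sup>2 * \<rho>\<^sup>2)" if "norm e \<le> \<alpha> * \<rho>" for E e
    proof -
      have "norm (e + d) \<le> (\<alpha> + 1) * \<rho>"
        using norm_triangle_ineq[of e d] that d(1) by (simp add: algebra_simps)
      then have "(norm (e + d))\<^sup>2 \<le> (\<alpha> + 1)\<^sup>2 * \<rho>\<^sup>2"
        by (metis norm_ge_zero power_mono power_mult_distrib)
      then show ?thesis by (intro mult_mono) auto
    qed
    have "inner u (a + d) \<le> \<bar>C\<bar> * ((\<alpha> + 1)\<^sup>2 * \<rho>\<^sup>2)"
      using C[OF d(2)] sq[OF ab(1), of C] by (simp add: add.assoc)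
    moreover have "inner v (b + d) \<le> \<bar>D\<bar> * ((\<alpha> + 1)\<^sup>2 * \<rho>\<^sup>2)"
      using D[OF d(3)] sq[OF ab(2), of D] by (simp add: add.assoc)
    moreover have "inner u (a + d) + inner v (b + d) = 2 * \<alpha> * \<rho> + inner (u + v) d"
      using u(2) v(2) by (simp add: a_def b_def inner_add flip: power2_norm_eq_inner)
    moreover have "- (norm (u + v) * \<rho>) \<le> inner (u + v) d"
      using Cauchy_Schwarz_ineq2[of "u + v" d] mult_left_mono[OF d(1), of "norm (u + v)"]
      by simp
    ultimately have "2 * \<alpha> * \<rho> \<le> norm (u + v) * \<rho> + K * \<rho>\<^sup>2"
      by (simp add: K_def algebra_simps)
    then have "(2 * \<alpha>) * \<rho> \<le> (norm (u + v) + K * \<rho>) * \<rho>"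
      by (simp add: algebra_simps power2_eq_square)
    then show ?thesis using \<rho>(1) by simp
  qed
  then have "eventually (\<lambda>\<rho>. 2 * \<alpha> \<le> norm (u + v) + K * \<rho>) (at_right 0)"
    using \<open>0 < \<delta>\<close> unfolding eventually_at_right_field by (intro exI[of _ \<delta>]) auto
  moreover have "((\<lambda>\<rho>. norm (u + v) + K * \<rho>) \<longlongrightarrow> norm (u + v) + K * 0) (at_right 0)"
    by (intro tendsto_intros)
  ultimately show ?thesis
    by (auto intro: tendsto_lowerbound)
qed

lemma strongly_regular_constants:
  assumes "closed A" "closed B" "x \<in> A \<inter> B" "strongly_regular [A, B] x"
  obtains \<alpha> \<delta> where "0 < \<alpha>" "\<alpha> \<le> 1 / 2" "0 < \<delta>"
    "linear_regularity_constant (1 / \<alpha>) A B x \<delta>"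
    "normal_angle_constant (1 - 2 * \<alpha>\<^sup>2) A B x \<delta>"
proof -
  obtain \<alpha> \<delta> where \<alpha>: "0 < \<alpha>" "\<alpha> \<le> 1 / 2" and "0 < \<delta>"
    and reg: "\<And>\<rho> p q a b. \<lbrakk>0 < \<rho>; \<rho> \<le> \<delta>; p \<in> A; q \<in> B; dist x p \<le> \<delta>; dist x q \<le> \<delta>;
        norm a \<le> \<alpha> * \<rho>; norm b \<le> \<alpha> * \<rho>\<rbrakk>
      \<Longrightarrow> \<exists>d. norm d \<le> \<rho> \<and> p + a + d \<in> A \<and> q + b + d \<in> B"
    by (rule strongly_regular_pairE[OF assms(4)]) (rule that)
  \<comment> \<open>Two demands fix the radius: \<open>m \<le> r\<close> must give
    \<open>m / \<alpha> \<le> \<delta>\<close>, and \<open>2 * r \<le> \<delta>\<close> must keep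
    the projections of points of the \<open>r\<close>-ball within \<delta> of
    \<open>x\<close>.\<close>
  define r where "r = \<alpha> * \<delta>"
  have r: "0 < r" "r \<le> \<delta> / 2"
    using \<alpha> \<open>0 < \<delta>\<close> mult_right_mono[OF \<alpha>(2), of \<delta>] by (simp_all add: r_def)
  have xA: "x \<in> A" and xB: "x \<in> B" using assms(3) by auto
  have "linear_regularity_constant (1 / \<alpha>) A B x r"
    unfolding linear_regularity_constant_def
  proof
    fix w assume "w \<in> cball x r"
    then have w: "dist w x \<le> r" by (simp add: dist_commute)
    obtain p where p: "p \<in> A" "infdist w A = dist w p"
      using infdist_attains_inf[of A w] assms xA by blast
    obtain q where q: "q \<in> B" "infdist w B = dist w q"
      using infdist_attains_inf[of B w] assms xB by blast
    have le: "dist w p \<le> r" "dist w q \<le> r"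
      using infdist_le[OF xA, of w] infdist_le[OF xB, of w] p q w by auto
    then have near: "dist x p \<le> \<delta>" "dist x q \<le> \<delta>"
      using dist_triangle[of x p w] dist_triangle[of x q w] w r(2) by (auto simp: dist_commute)
    define m where "m = max (dist w p) (dist w q)"
    have m: "dist w p \<le> m" "dist w q \<le> m" by (simp_all add: m_def)
    have "infdist w (A \<inter> B) \<le> m / \<alpha>"
    \<comment> \<open>Strong regularity needs a positive radius \<open>m / \<alpha>\<close>, so
      points already in both sets are treated apart.\<close>
    proof (cases "m = 0")
      case True
      then have "w = p" "w = q" using m by auto
      then show ?thesis using True p(1) q(1) by simp
    next
      case False
      then have "0 < m" using m(1) zero_le_dist[of w p] by linarith
      moreover have "m / \<alpha> \<le> \<delta>"
        using le \<alpha>(1) by (simp add: m_def r_def pos_divide_le_eq mult.commute)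
      moreover have "norm (w - p) \<le> \<alpha> * (m / \<alpha>)" "norm (w - q) \<le> \<alpha> * (m / \<alpha>)"
        using \<alpha>(1) by (simp_all add: m_def dist_norm)
      ultimately obtain d where d: "norm d \<le> m / \<alpha>" "p + (w - p) + d \<in> A" "q + (w - q) + d \<in> B"
        using reg[of "m / \<alpha>" p q "w - p" "w - q"] p q near \<alpha>(1) by auto
      then have "w + d \<in> A \<inter> B" by simp
      from infdist_le[OF this, of w] d(1) show ?thesis by (simp add: dist_norm)
    qed
    then show "infdist w (A \<inter> B) \<le> 1 / \<alpha> * max (infdist w A) (infdist w B)"
      by (simp add: p q m_def)
  qed
  moreover have "normal_angle_constant (1 - 2 * \<alpha>\<^sup>2) A B x r"
    unfolding normal_angle_constant_def
  proof safe
    fix z u y v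
    assume z: "z \<in> A" "z \<in> cball x r" and y: "y \<in> B" "y \<in> cball x r"
      and u: "u \<in> limiting_normal_cone A z" "u \<in> cball 0 1"
      and v: "v \<in> limiting_normal_cone B y" "v \<in> cball 0 1"
    let ?c = "1 - 2 * \<alpha>\<^sup>2"
    \<comment> \<open>The sign of \<open>?c\<close> matters at the end, where
      \<open>norm u * norm v\<close> is replaced by its upper bound 1.\<close>
    have "\<alpha>\<^sup>2 \<le> (1 / 2)\<^sup>2" using \<alpha> by (intro power_mono) auto
    then have c: "0 \<le> ?c" by (simp add: power2_eq_square)
    obtain Z U where Z: "\<And>k. Z k \<in> A" "Z \<longlonglongrightarrow> z"
      and U: "\<And>k. U k \<in> prox_normal_cone A (Z k)" "U \<longlonglongrightarrow> u"
      using u(1) unfolding limiting_normal_cone_def by blast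
    obtain Y V where Y: "\<And>k. Y k \<in> B" "Y \<longlonglongrightarrow> y"
      and V: "\<And>k. V k \<in> prox_normal_cone B (Y k)" "V \<longlonglongrightarrow> v"
      using v(1) unfolding limiting_normal_cone_def by blast
    \<comment> \<open>The approximating points may leave the \<open>r\<close>-ball; the strict
      inequality puts them within \<delta> of \<open>x\<close> eventually.\<close>
    have lt: "dist x z < \<delta>" "dist x y < \<delta>" using z y r \<open>0 < \<delta>\<close> by auto
    have "(\<lambda>k. dist x (Z k)) \<longlonglongrightarrow> dist x z" "(\<lambda>k. dist x (Y k)) \<longlonglongrightarrow> dist x y"
      using Z Y by (auto intro!: tendsto_intros)
    from this[THEN order_tendstoD(2)] lt
    have "\<forall>\<^sub>F k in sequentially. dist x (Z k) < \<delta>" "\<forall>\<^sub>F k in sequentially. dist x (Y k) < \<delta>"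
      by blast+
    \<comment> \<open>Multiplied out by the norms, the angle bound also covers vanishing normals and
      passes to the limit by continuity.\<close>
    then have "\<forall>\<^sub>F k in sequentially. 0 \<le> inner (U k) (V k) + ?c * norm (U k) * norm (V k)"
    proof eventually_elim
      case (elim k)
      show ?case
      proof (cases "U k = 0 \<or> V k = 0")
        case False
        let ?u = "(1 / norm (U k)) *\<^sub>R U k" and ?v = "(1 / norm (V k)) *\<^sub>R V k"
        have "2 * \<alpha> \<le> norm (?u + ?v)"
        proof (rule norm_add_unit_prox_normals_ge)
          show "?u \<in> prox_normal_cone A (Z k)" "?v \<in> prox_normal_cone B (Y k)"
            using U V False by (auto intro!: prox_normal_cone_scaleR)
          show "\<And>\<rho> a b. \<lbrakk>0 < \<rho>; \<rho> \<le> \<delta>; norm a \<le> \<alpha> * \<rho>; norm b \<le> \<alpha> * \<rho>\<rbrakk>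
            \<Longrightarrow> \<exists>d. norm d \<le> \<rho> \<and> Z k + a + d \<in> A \<and> Y k + b + d \<in> B"
            using reg Z(1) Y(1) elim by simp
        qed (use \<alpha> \<open>0 < \<delta>\<close> False in auto)
        \<comment> \<open>For unit vectors the squared norm of the sum is 2 plus twice their inner
          product, so the inner product is at least \<open>2 * \<alpha>\<^sup>2 - 1\<close>.\<close>
        then have "(2 * \<alpha>)\<^sup>2 \<le> (norm (?u + ?v))\<^sup>2" using \<alpha> by (intro power_mono) auto
        also have "\<dots> = (norm ?u)\<^sup>2 + (norm ?v)\<^sup>2 + 2 * inner ?u ?v"
          unfolding power2_norm_eq_inner by (simp add: algebra_simps inner_commute)
        also have "\<dots> = 2 + 2 * (inner (U k) (V k) / (norm (U k) * norm (V k)))"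
          using False by simp
        finally have "- ?c \<le> inner (U k) (V k) / (norm (U k) * norm (V k))"
          by (simp add: power_mult_distrib)
        then have "- ?c * (norm (U k) * norm (V k)) \<le> inner (U k) (V k)"
          using False by (subst (asm) pos_le_divide_eq) auto
        then show ?thesis by (simp add: algebra_simps)
      qed auto
    qed
    moreover have "(\<lambda>k. inner (U k) (V k) + ?c * norm (U k) * norm (V k))
        \<longlonglongrightarrow> inner u v + ?c * norm u * norm v"
      using U V by (intro tendsto_intros)
    ultimately have "0 \<le> inner u v + ?c * norm u * norm v"
      by (intro tendsto_lowerbound) auto
    moreover have "norm u * norm v \<le> 1 * 1"
      using u(2) v(2) by (intro mult_mono) auto
    then have "?c * (norm u * norm v) \<le> ?c * 1"
      using c by (intro mult_left_mono) auto
    ultimately show "- ?c \<le> inner u v" by (simp add: mult.assoc)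
  qed
  ultimately show ?thesis using that \<alpha> r(1) by blast
qed

section \<open>Smaller balls, and subregularity from super-regularity\<close>

lemma linear_regularity_constant_antimono:
  "linear_regularity_constant \<kappa> A B x \<delta> \<Longrightarrow> \<delta>' \<le> \<delta> \<Longrightarrow> linear_regularity_constant \<kappa> A B x \<delta>'"
  unfolding linear_regularity_constant_def by auto

lemma normal_angle_constant_antimono:
  "normal_angle_constant c A B x \<delta> \<Longrightarrow> \<delta>' \<le> \<delta> \<Longrightarrow> normal_angle_constant c A B x \<delta>'"
  using subset_cball[of \<delta>' \<delta> x] unfolding normal_angle_constant_def by blast

text \<open>Proximal normals are limiting normals and points of \<open>A \<inter> B\<close> lie in
  \<open>A\<close>. The bound on the new radius lets the other two constants survive on the smaller
  ball.\<close>

lemma super_regular_imp_subregular: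
  assumes "super_regular A x" "0 < \<epsilon>" "0 < \<delta>"
  obtains \<delta>' where "0 < \<delta>'" "\<delta>' \<le> \<delta>" "subregular \<epsilon> \<delta>' A x (A \<inter> B)"
proof -
  obtain \<eta> where "\<eta> > 0"
    and \<eta>: "\<And>p s v. \<lbrakk>p \<in> cball x \<eta> \<inter> A; s \<in> cball x \<eta> \<inter> A; v \<in> limiting_normal_cone A p\<rbrakk>
      \<Longrightarrow> inner v (s - p) \<le> \<epsilon> * norm v * norm (s - p)"
    using assms(1)[unfolded super_regular_def, rule_format, OF assms(2)] by blast
  have "subregular \<epsilon> (min \<eta> \<delta>) A x (A \<inter> B)"
    unfolding subregular_def
  proof (intro ballI)
    fix p s v
    assume *: "p \<in> cball x (min \<eta> \<delta>) \<inter> A" "s \<in> A \<inter> B \<inter> cball x (min \<eta> \<delta>)"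
      "v \<in> prox_normal_cone A p"
    then have "v \<in> limiting_normal_cone A p"
      using prox_normal_cone_subset_limiting by blast
    with * show "inner v (s - p) \<le> \<epsilon> * norm v * norm (s - p)"
      by (intro \<eta>) auto
  qed
  then show ?thesis
    using that[of "min \<eta> \<delta>"] \<open>\<eta> > 0\<close> \<open>0 < \<delta>\<close> by simp
qed

section \<open>Reflection in a subspace and averaged reflections\<close>

text \<open>Along with \<open>b\<close>, the subspace contains its mirror image
  \<open>2 *\<^sub>R y - b\<close> about \<open>y\<close>, so the variational inequality of the
  projection holds with both signs.\<close>

lemma projector_subspace_orthogonal:
  assumes "subspace B" "y \<in> projector B x" "b \<in> B"
  shows "inner (x - y) (b - y) = 0"
proof -
  have y: "y \<in> B" and min: "\<forall>z\<in>B. dist x y \<le> dist x z"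
    using assms(2) by (auto simp: projector_def dist_norm[symmetric] infdist_le)
  have le: "inner (x - y) (z - y) \<le> 0" if "z \<in> B" for z
    using any_closest_point_dot[OF subspace_imp_convex closed_subspace y that min] assms(1)
    by blast
  have "2 *\<^sub>R y - b \<in> B"
    using assms(1,3) y by (simp add: subspace_diff subspace_scale)
  from le[OF this] le[OF assms(3)] show ?thesis
    by (simp add: inner_diff_right scaleR_2 inner_add_right)
qed

text \<open>Reflection reverses \<open>x - y\<close>, which is orthogonal to
  \<open>y - b\<close>.\<close>

lemma norm_reflector_subspace_diff:
  assumes "subspace B" "y \<in> projector B x" "b \<in> B"
  shows "norm (2 *\<^sub>R y - x - b) = norm (x - b)"
proof -
  have "inner (x - y) (b - y) = 0" by (rule projector_subspace_orthogonal[OF assms])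
  then have "(norm (2 *\<^sub>R y - x - b))\<^sup>2 = (norm (x - b))\<^sup>2"
    unfolding power2_norm_eq_inner by (simp add: algebra_simps inner_commute scaleR_2)
  then show ?thesis by simp
qed

lemma norm_averaged_reflection_le:
  fixes x w z s :: "'a::real_inner"
  assumes "0 \<le> \<epsilon>" "\<epsilon> \<le> 1 / 2" "norm (w - s) = norm (x - s)"
    and sub: "inner (w - z) (s - z) \<le> \<epsilon> * norm (w - z) * norm (s - z)"
    and xp: "xp = (1 / 2) *\<^sub>R (2 *\<^sub>R z - w + x)"
  shows "(norm (xp - s))\<^sup>2 + (norm (xp - x))\<^sup>2 \<le> (1 + 2 * \<epsilon> + 2 * \<epsilon>\<^sup>2) * (norm (x - s))\<^sup>2"
proof -
  define u t where "u = norm (w - z)" and "t = norm (s - z)"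
  have ws: "(norm (w - s))\<^sup>2 = u\<^sup>2 + t\<^sup>2 - 2 * inner (w - z) (s - z)"
    unfolding u_def t_def power2_norm_eq_inner by (simp add: algebra_simps inner_commute)
  \<comment> \<open>This is the median identity for \<open>xp\<close> as midpoint of
    \<open>x\<close> and \<open>2 *\<^sub>R z - w\<close>, with
    \<open>norm (2 *\<^sub>R z - w - s)\<close> expanded around \<open>w - s\<close>.\<close>
  have split: "(norm (xp - s))\<^sup>2 + (norm (xp - x))\<^sup>2
      = (norm (x - s))\<^sup>2 / 2 + (norm (w - s))\<^sup>2 / 2 + 2 * inner (w - z) (s - z)"
    unfolding xp power2_norm_eq_inner
    by (simp add: algebra_simps inner_commute scaleR_2 add_divide_distrib diff_divide_distrib)
  have "2 * (u * t) \<le> u\<^sup>2 + t\<^sup>2"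
    using sum_squares_bound[of u t] by simp
  \<comment> \<open>Subregularity makes the angle at \<open>z\<close> nearly obtuse, so the product
    \<open>u * t\<close> is controlled by the squared distance from \<open>w\<close> to
    \<open>s\<close>.\<close>
  then have "(2 - 2 * \<epsilon>) * (u * t) \<le> (norm (w - s))\<^sup>2"
    using sub ws by (simp add: u_def t_def algebra_simps)
  moreover have "1 * (u * t) \<le> (2 - 2 * \<epsilon>) * (u * t)"
    using \<open>\<epsilon> \<le> 1 / 2\<close> by (intro mult_right_mono) (auto simp: u_def t_def)
  ultimately have "u * t \<le> (norm (x - s))\<^sup>2" using assms(3) by simp
  then have "\<epsilon> * (u * t) \<le> \<epsilon> * (norm (x - s))\<^sup>2"
    using assms(1) by (rule mult_left_mono)
  then have "(norm (xp - s))\<^sup>2 + (norm (xp - x))\<^sup>2 \<le> (1 + 2 * \<epsilon>) * (norm (x - s))\<^sup>2"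
    using sub split assms(3) by (simp add: u_def t_def algebra_simps)
  also have "\<dots> \<le> (1 + 2 * \<epsilon> + 2 * \<epsilon>\<^sup>2) * (norm (x - s))\<^sup>2"
    by (intro mult_right_mono) auto
  finally show ?thesis .
qed

section \<open>Contraction in one Douglas-Rachford step\<close>

lemma normal_angle_constant_prox:
  assumes "normal_angle_constant c A B x \<delta>"
    and z: "z \<in> A" "dist x z \<le> \<delta>" "u \<in> prox_normal_cone A z"
    and y: "y \<in> B" "dist x y \<le> \<delta>" "v \<in> prox_normal_cone B y"
  shows "- (c * norm u * norm v) \<le> inner u v"
proof (cases "u = 0 \<or> v = 0")
  case False
  let ?u = "(1 / norm u) *\<^sub>R u" and ?v = "(1 / norm v) *\<^sub>R v"
  have "?u \<in> limiting_normal_cone A z \<inter> cball 0 1" "?v \<in> limiting_normal_cone B y \<inter> cball 0 1"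
    using False prox_normal_cone_scaleR[OF z(3), of "1 / norm u"]
      prox_normal_cone_scaleR[OF y(3), of "1 / norm v"]
      prox_normal_cone_subset_limiting[OF z(1)] prox_normal_cone_subset_limiting[OF y(1)]
    by auto
  then have "- c \<le> inner ?u ?v"
    using assms(1) z(1,2) y(1,2) unfolding normal_angle_constant_def
    by (metis IntI mem_cball)
  then have "- c \<le> inner u v / (norm u * norm v)" by (simp add: mult.commute)
  then show ?thesis using False by (simp add: pos_le_divide_eq algebra_simps)
qed auto

lemma douglas_rachford_step:
  assumes B: "subspace B" and A: "closed A" and xhat: "xhat \<in> A \<inter> B"
    and "0 < \<kappa>" "0 \<le> c" "c \<le> 1" "0 \<le> \<epsilon>" "\<epsilon> \<le> 1 / 2"
    and lin: "linear_regularity_constant \<kappa> A B xhat \<delta>"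
    and ang: "normal_angle_constant c A B xhat \<delta>"
    and sub: "subregular \<epsilon> \<delta> A xhat (A \<inter> B)"
    and x: "dist xhat x \<le> \<delta> / 2" and xp: "xp \<in> douglas_rachford A B x"
  shows "(infdist xp (A \<inter> B))\<^sup>2
    \<le> (1 + 2 * \<epsilon> + 2 * \<epsilon>\<^sup>2 - (1 - c) / \<kappa>\<^sup>2) * (infdist x (A \<inter> B))\<^sup>2"
proof -
  obtain y w z where y: "y \<in> projector B x" and w: "w = 2 *\<^sub>R y - x"
    and z: "z \<in> projector A w" and xp: "xp = (1 / 2) *\<^sub>R (2 *\<^sub>R z - w + x)"
    using xp unfolding douglas_rachford_def mcomp_def reflector_def by blast
  have yB: "y \<in> B" and zA: "z \<in> A" and dy: "norm (x - y) = infdist x B"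
    and dz: "norm (w - z) = infdist w A"
    using y z by (auto simp: projector_def)
  have S: "closed (A \<inter> B)" "A \<inter> B \<noteq> {}"
    using A closed_subspace[OF B] xhat by auto
  have refl: "norm (w - b) = norm (x - b)" if "b \<in> B" for b
    unfolding w using norm_reflector_subspace_diff[OF B y that] .
  have w_near: "dist xhat w \<le> \<delta> / 2"
    using refl[of xhat] xhat x by (simp add: dist_norm norm_minus_commute)
  \<comment> \<open>A nearest point in a set containing \<open>xhat\<close> is at most twice as far
    from \<open>xhat\<close>; hence the restriction of \<open>x\<close> to half the radius.\<close>
  have "dist w z \<le> dist w xhat" "dist x y \<le> dist x xhat"
    using dz dy infdist_le[of xhat A w] infdist_le[of xhat B x] xhat by (auto simp: dist_norm)
  moreover have "0 \<le> \<delta>"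
    using x zero_le_dist[of xhat x] by linarith
  ultimately have near: "dist xhat z \<le> \<delta>" "dist xhat y \<le> \<delta>" "dist xhat w \<le> \<delta>"
    using dist_triangle[of xhat z w] dist_triangle[of xhat y x] x w_near
    by (auto simp: dist_commute)
  have u: "w - z \<in> prox_normal_cone A z" and v: "x - y \<in> prox_normal_cone B y"
    using z y by (auto intro: prox_normal_coneI)

  \<comment> \<open>The step is minus the sum of a normal to \<open>A\<close> and a normal to
    \<open>B\<close>, so the angle constant prevents cancellation.\<close>
  have diff: "xp - x = - ((w - z) + (x - y))"
    unfolding xp w by (simp add: algebra_simps scaleR_2 flip: scaleR_add_left)
  define a b where "a = norm (w - z)" and "b = norm (x - y)"
  have "- (c * a * b) \<le> inner (w - z) (x - y)"
    unfolding a_def b_def by (rule normal_angle_constant_prox[OF ang zA near(1) u yB near(2) v])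
  moreover have "(norm (xp - x))\<^sup>2 = a\<^sup>2 + b\<^sup>2 + 2 * inner (w - z) (x - y)"
    unfolding diff a_def b_def norm_minus_cancel power2_norm_eq_inner
    by (simp add: algebra_simps inner_commute)
  moreover have "c * (2 * a * b) \<le> c * (a\<^sup>2 + b\<^sup>2)"
    using \<open>0 \<le> c\<close> sum_squares_bound[of a b] by (intro mult_left_mono) auto
  ultimately have step1: "(1 - c) * (a\<^sup>2 + b\<^sup>2) \<le> (norm (xp - x))\<^sup>2"
    by (simp add: algebra_simps)

  \<comment> \<open>Linear regularity is applied at \<open>w\<close>, whose distances to
    \<open>A\<close> and \<open>B\<close> are bounded by \<open>a\<close> and \<open>b\<close>. The
    result transfers to \<open>x\<close> because \<open>s'\<close> lies in \<open>B\<close> and is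
    equidistant from \<open>x\<close> and \<open>w\<close>.\<close>
  obtain s' where s': "s' \<in> A \<inter> B" "infdist w (A \<inter> B) = dist w s'"
    using infdist_attains_inf[OF S] by blast
  have "infdist x (A \<inter> B) \<le> infdist w (A \<inter> B)"
    using infdist_le[OF s'(1), of x] refl[of s'] s' by (simp add: dist_norm)
  also have "\<dots> \<le> \<kappa> * max (infdist w A) (infdist w B)"
    using lin near(3) unfolding linear_regularity_constant_def by simp
  also have "infdist w B \<le> b"
    using infdist_le[OF yB, of w] refl[OF yB] by (simp add: dist_norm b_def)
  then have "\<kappa> * max (infdist w A) (infdist w B) \<le> \<kappa> * max a b"
    using \<open>0 < \<kappa>\<close> dz by (intro mult_left_mono) (auto simp: a_def)
  finally have "(infdist x (A \<inter> B))\<^sup>2 \<le> (\<kappa> * max a b)\<^sup>2"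
    by (intro power_mono) (auto simp: infdist_nonneg)
  also have "\<dots> \<le> \<kappa>\<^sup>2 * (a\<^sup>2 + b\<^sup>2)"
    unfolding power_mult_distrib by (intro mult_left_mono) (auto simp: max_def)
  finally have "(infdist x (A \<inter> B))\<^sup>2 / \<kappa>\<^sup>2 \<le> a\<^sup>2 + b\<^sup>2"
    using \<open>0 < \<kappa>\<close> by (simp add: pos_divide_le_eq mult.commute)
  then have "(1 - c) * ((infdist x (A \<inter> B))\<^sup>2 / \<kappa>\<^sup>2) \<le> (1 - c) * (a\<^sup>2 + b\<^sup>2)"
    using \<open>c \<le> 1\<close> by (intro mult_left_mono) auto
  with step1 have coercive: "(1 - c) / \<kappa>\<^sup>2 * (infdist x (A \<inter> B))\<^sup>2 \<le> (norm (xp - x))\<^sup>2"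
    by simp

  obtain s where s: "s \<in> A \<inter> B" "infdist x (A \<inter> B) = dist x s"
    using infdist_attains_inf[OF S] by blast
  have "dist x s \<le> dist x xhat" using infdist_le[OF xhat, of x] s by simp
  then have "dist xhat s \<le> \<delta>"
    using dist_triangle[of xhat s x] x by (simp add: dist_commute)
  then have "inner (w - z) (s - z) \<le> \<epsilon> * norm (w - z) * norm (s - z)"
    using sub zA near(1) s(1) u unfolding subregular_def by simp
  then have "(norm (xp - s))\<^sup>2 + (norm (xp - x))\<^sup>2
      \<le> (1 + 2 * \<epsilon> + 2 * \<epsilon>\<^sup>2) * (norm (x - s))\<^sup>2"
    using norm_averaged_reflection_le[OF \<open>0 \<le> \<epsilon>\<close> \<open>\<epsilon> \<le> 1 / 2\<close> _ _ xp] refl[of s] s(1) by blast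
  moreover have "(infdist xp (A \<inter> B))\<^sup>2 \<le> (norm (xp - s))\<^sup>2"
    using infdist_le[OF s(1), of xp] by (intro power_mono) (auto simp: dist_norm infdist_nonneg)
  ultimately show ?thesis
    using coercive s(2) by (simp add: dist_norm algebra_simps)
qed

section \<open>Choice of the constants and the linear rate\<close>

theorem theorem42:
  fixes A B :: "'a::euclidean_space set" and xhat :: 'a
  assumes "subspace B"
    and "closed A"
    and "xhat \<in> A \<inter> B"
    and "super_regular A xhat"
    and "\<forall>s \<in> A \<inter> B. strongly_regular [A, B] s"
  shows "\<exists>\<delta> \<kappa> c \<epsilon>. 0 < \<delta> \<and> 0 < \<kappa> \<and> 0 < c \<and> c < 1 \<and> 0 \<le> \<epsilon> \<and>
           linear_regularity_constant \<kappa> A B xhat \<delta> \<and>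
           normal_angle_constant c A B xhat \<delta> \<and>
           subregular \<epsilon> \<delta> A xhat (A \<inter> B) \<and>
           (1 - c) / \<kappa>\<^sup>2 > 2 * \<epsilon> + 2 * \<epsilon>\<^sup>2 \<and>
           0 \<le> 1 + 2 * \<epsilon> + 2 * \<epsilon>\<^sup>2 - (1 - c) / \<kappa>\<^sup>2 \<and>
           sqrt (1 + 2 * \<epsilon> + 2 * \<epsilon>\<^sup>2 - (1 - c) / \<kappa>\<^sup>2) < 1 \<and>
           (\<forall>x \<in> cball xhat (\<delta> / 2). \<forall>xplus \<in> douglas_rachford A B x.
              infdist xplus (A \<inter> B)
                \<le> sqrt (1 + 2 * \<epsilon> + 2 * \<epsilon>\<^sup>2 - (1 - c) / \<kappa>\<^sup>2) * infdist x (A \<inter> B))"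
proof -
  have xhat: "xhat \<in> A \<inter> B" and clB: "closed B"
    using assms(1,3) closed_subspace by auto
  obtain \<alpha> \<delta>\<^sub>0 where \<alpha>: "0 < \<alpha>" "\<alpha> \<le> 1 / 2" and "0 < \<delta>\<^sub>0"
    and lin0: "linear_regularity_constant (1 / \<alpha>) A B xhat \<delta>\<^sub>0"
    and ang0: "normal_angle_constant (1 - 2 * \<alpha>\<^sup>2) A B xhat \<delta>\<^sub>0"
    using strongly_regular_constants[OF assms(2) clB xhat bspec[OF assms(5) xhat]] by blast
  define \<kappa> c \<epsilon> where "\<kappa> = 1 / \<alpha>" and "c = 1 - 2 * \<alpha>\<^sup>2" and "\<epsilon> = \<alpha> ^ 4 / 2"
  have "0 < \<alpha>\<^sup>2" "\<alpha>\<^sup>2 \<le> (1 / 2)\<^sup>2" "0 < \<alpha> ^ 4" "\<alpha> ^ 4 \<le> (1 / 2) ^ 4"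
    using \<alpha> by (auto intro!: power_mono)
  then have c: "0 < c" "c < 1" and \<epsilon>: "0 < \<epsilon>" "\<epsilon> \<le> 1 / 2" and "\<epsilon> < 1"
    by (auto simp: c_def \<epsilon>_def power_divide)
  have \<kappa>: "0 < \<kappa>" using \<alpha> by (simp add: \<kappa>_def)
  \<comment> \<open>The gap now reduces to \<open>\<epsilon>\<^sup>2 < \<epsilon>\<close>, and the
    radicand becomes \<open>1 - 2 * \<epsilon> + 2 * \<epsilon>\<^sup>2\<close>.\<close>
  have q: "(1 - c) / \<kappa>\<^sup>2 = 4 * \<epsilon>"
    by (simp add: c_def \<kappa>_def \<epsilon>_def power_divide flip: power_add)
  have "\<epsilon>\<^sup>2 < \<epsilon>" using \<epsilon>(1) \<open>\<epsilon> < 1\<close> by (simp add: power2_eq_square)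
  then have gap: "2 * \<epsilon> + 2 * \<epsilon>\<^sup>2 < (1 - c) / \<kappa>\<^sup>2" by (simp add: q)
  have nonneg: "0 \<le> 1 + 2 * \<epsilon> + 2 * \<epsilon>\<^sup>2 - (1 - c) / \<kappa>\<^sup>2"
    unfolding q using \<epsilon> zero_le_power2[of \<epsilon>] by linarith
  \<comment> \<open>No circularity arises: \<epsilon> depends on \<alpha> alone, and shrinking the
    ball afterwards preserves \<open>\<kappa>\<close> and \<open>c\<close>.\<close>
  obtain \<delta> where "0 < \<delta>" "\<delta> \<le> \<delta>\<^sub>0" and sub: "subregular \<epsilon> \<delta> A xhat (A \<inter> B)"
    using super_regular_imp_subregular[OF assms(4) \<epsilon>(1) \<open>0 < \<delta>\<^sub>0\<close>] by blast
  have lin: "linear_regularity_constant \<kappa> A B xhat \<delta>"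
    using linear_regularity_constant_antimono[OF lin0 \<open>\<delta> \<le> \<delta>\<^sub>0\<close>] by (simp add: \<kappa>_def)
  have ang: "normal_angle_constant c A B xhat \<delta>"
    using normal_angle_constant_antimono[OF ang0 \<open>\<delta> \<le> \<delta>\<^sub>0\<close>] by (simp add: c_def)
  let ?r = "1 + 2 * \<epsilon> + 2 * \<epsilon>\<^sup>2 - (1 - c) / \<kappa>\<^sup>2"
  have "infdist xp (A \<inter> B) \<le> sqrt ?r * infdist x (A \<inter> B)"
    if "x \<in> cball xhat (\<delta> / 2)" "xp \<in> douglas_rachford A B x" for x xp
  proof -
    have "(infdist xp (A \<inter> B))\<^sup>2 \<le> ?r * (infdist x (A \<inter> B))\<^sup>2"
      using douglas_rachford_step[OF assms(1,2) xhat \<kappa> _ _ _ \<epsilon>(2) lin ang sub _ that(2)]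
        c \<epsilon>(1) that(1) by simp
    then have "infdist xp (A \<inter> B) \<le> sqrt (?r * (infdist x (A \<inter> B))\<^sup>2)"
      by (rule real_le_rsqrt)
    then show ?thesis by (simp add: real_sqrt_mult infdist_nonneg)
  qed
  moreover have "sqrt ?r < 1" using gap by (simp add: real_sqrt_lt_1_iff)
  ultimately show ?thesis
    using \<open>0 < \<delta>\<close> \<kappa> c \<epsilon>(1) lin ang sub gap nonneg
    by (intro exI[of _ \<delta>] exI[of _ \<kappa>] exI[of _ c] exI[of _ \<epsilon>]) auto
qed

end
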